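(* Let $T\in\mathbb{N}$, $d\ge 2$, and let $\mathcal{A}$ be any randomized algorithm with access to a local oracle of the objective $\phi=F+h$, generating points $x_1,\ldots,x_T\in\mathbb{R}^d$. Then there exist functions $F:\mathbb{R}^d\to\mathbb{R}$ and $h:\mathbb{R}^d\to(-\infty,+\infty]$ satisfying the standing assumptions (A1)-(A2) given in the context such that $\phi(0)-\inf_{x\in\mathbb{R}^d}\phi(x)\le 2$, but with probability at least $1-2T\exp(-d/36)$, for all $\epsilon\in\big(0,\tfrac{1}{4\sqrt2}\big)$ and all $\gamma\in(0,0.1]$, none of the points $x_1,\dots,x_T$ generated by $\mathcal{A}$ (when run on this $F,h$) is a $(\gamma,\epsilon)$-PGSP and none of them is an $\epsilon$-CGGSP.
   Context: The problem is $\min_{x\in\mathbb{R}^d}\phi(x):=F(x)+h(x)$ with $F(x)=\mathbb{E}_{\xi\sim\mathcal{P}}[f_\xi(x)]$. (A1) For every sample $\xi$, $f_\xi:\mathbb{R}^d\to\mathbb{R}$ is $L_\xi$-Lipschitz continuous for some $L_\xi>0$, and $\mathbb{E}_\xi[L_\xi^2]\le G^2$ for some $G>0$. (A deterministic $F$ is the case $f_\xi\equiv F$.) (A2) $h:\mathbb{R}^d\to(-\infty,+\infty]$ is a proper closed convex function with at least one point $x^{(h)}$ such that $h(x^{(h)})<+\infty$. Local oracle: a quantity $\mathcal{O}_{F,h}(x)$ (e.g. $F(x)$, $\nabla F(x)+\partial h(x)$) that reveals only local information about the values of $F$ and $h$ around $x$; that is, if $F=\widetilde F$ and $h=\widetilde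 h$ on a neighborhood of $x$, then $\mathcal{O}_{F,h}(x)=\mathcal{O}_{\widetilde F,\widetilde h}(x)$. A randomized algorithm with access to the oracle chooses each $x_t$ as a function of its internal randomness and of the oracle answers at the previous points $x_1,\dots,x_{t-1}$. Clarke subdifferential of a Lipschitz function $F$: $\partial F(x)=\{g\in\mathbb{R}^d:\langle g,v\rangle\le DF(x;v)\ \forall v\in\mathbb{R}^d\}$, where $DF(x;v)=\limsup_{y\to x,\,t\downarrow 0}\frac{F(y+tv)-F(y)}{t}$. Proximal operator: ${\rm prox}_{\gamma h}(x)=\arg\min_{y\in\mathbb{R}^d}\big[h(y)+\frac{1}{2\gamma}\|y-x\|^2\big]$. Proximal gradient mapping: $\mathcal{G}_{\gamma h}(x,g)=\frac1\gamma[x-{\rm prox}_{\gamma h}(x-\gamma g)]$. A point $x$ is a $(\gamma,\epsilon)$-PGSP (proximal Goldstein stationary point) if $\min_{g\in\partial F(x)}\|\mathcal{G}_{\gamma h}(x,g)\|\le\epsilon$. Frank-Wolfe gap: $\mathcal{W}_h(x,g)=\max_{y\in\mathbb{R}^d}\big[h(x)-h(y)+\langle y-x,-g\rangle\big]$. A point $x$ is an $\epsilon$-CGGSP (conditional gradient Goldstein stationary point) if $\min_{g\in\partial F(x)}\mathcal{W}_h(x,g)\le\epsilon$. *)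

theory Defs
  imports "HOL-Probability.Probability"
begin

text \<open>The sample space of \<open>\<xi>\<close> is a probability space on the reals. The class of functions \<open>F\<close> so
  described does not depend on this choice: it contains every Lipschitz function (take the
  integrands constant in \<open>\<xi>\<close>).\<close>

definition expected_lipschitz :: "('a::euclidean_space \<Rightarrow> real) \<Rightarrow> bool" where
  "expected_lipschitz F \<longleftrightarrow>
    (\<exists>(P :: real measure) (f :: real \<Rightarrow> 'a \<Rightarrow> real) (L :: real \<Rightarrow> real) (G :: real).
       prob_space P \<and>
       (\<forall>x. integrable P (\<lambda>\<xi>. f \<xi> x) \<and> F x = (\<integral>\<xi>. f \<xi> x \<partial>P)) \<and>
       (\<forall>\<xi>\<in>space P. L \<xi> > 0 \<and> (L \<xi>)-lipschitz_on UNIV (f \<xi>)) \<and>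
       G > 0 \<and> integrable P (\<lambda>\<xi>. (L \<xi>)\<^sup>2) \<and> (\<integral>\<xi>. (L \<xi>)\<^sup>2 \<partial>P) \<le> G\<^sup>2)"

definition ereal_epigraph :: "('a \<Rightarrow> ereal) \<Rightarrow> ('a \<times> real) set" where
  "ereal_epigraph h = {(x, r). h x \<le> ereal r}"

definition proper_closed_convex :: "('a::euclidean_space \<Rightarrow> ereal) \<Rightarrow> bool" where
  "proper_closed_convex h \<longleftrightarrow>
     (\<forall>x. h x \<noteq> -\<infinity>) \<and> (\<exists>x. h x < \<infinity>) \<and>
     closed (ereal_epigraph h) \<and> convex (ereal_epigraph h)"

definition admissible :: "('a::euclidean_space \<Rightarrow> real) \<Rightarrow> ('a \<Rightarrow> ereal) \<Rightarrow> bool" where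
  "admissible F h \<longleftrightarrow> expected_lipschitz F \<and> proper_closed_convex h"

definition objective :: "('a \<Rightarrow> real) \<Rightarrow> ('a \<Rightarrow> ereal) \<Rightarrow> 'a \<Rightarrow> ereal" where
  "objective F h x = ereal (F x) + h x"

definition clarke_dir_deriv :: "('a::euclidean_space \<Rightarrow> real) \<Rightarrow> 'a \<Rightarrow> 'a \<Rightarrow> ereal" where
  "clarke_dir_deriv F x v =
     Limsup (nhds x \<times>\<^sub>F at_right 0) (\<lambda>(y, t). ereal ((F (y + t *\<^sub>R v) - F y) / t))"

definition clarke_subdiff :: "('a::euclidean_space \<Rightarrow> real) \<Rightarrow> 'a \<Rightarrow> 'a set" where
  "clarke_subdiff F x = {g. \<forall>v. ereal (g \<bullet> v) \<le> clarke_dir_deriv F x v}"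

text \<open>The choice made by \<open>arg_min\<close> is immaterial: for \<open>\<gamma> > 0\<close> and \<open>h\<close> proper, closed and convex,
  the minimizer exists and is unique.\<close>

definition prox :: "real \<Rightarrow> ('a::euclidean_space \<Rightarrow> ereal) \<Rightarrow> 'a \<Rightarrow> 'a" where
  "prox \<gamma> h x = arg_min (\<lambda>y. h y + ereal (1 / (2 * \<gamma>) * (norm (y - x))\<^sup>2)) (\<lambda>_. True)"

definition prox_grad_mapping ::
  "real \<Rightarrow> ('a::euclidean_space \<Rightarrow> ereal) \<Rightarrow> 'a \<Rightarrow> 'a \<Rightarrow> 'a" where
  "prox_grad_mapping \<gamma> h x g = (1 / \<gamma>) *\<^sub>R (x - prox \<gamma> h (x - \<gamma> *\<^sub>R g))"

text \<open>For admissible \<open>F\<close> and \<open>h\<close> the infima over the (compact, nonempty) Clarke subdifferential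
  below are attained, so they are minima. The supremum in \<open>frank_wolfe_gap\<close> may be infinite.\<close>

definition PGSP ::
  "('a::euclidean_space \<Rightarrow> real) \<Rightarrow> ('a \<Rightarrow> ereal) \<Rightarrow> real \<Rightarrow> real \<Rightarrow> 'a \<Rightarrow> bool" where
  "PGSP F h \<gamma> \<epsilon> x \<longleftrightarrow>
     (INF g\<in>clarke_subdiff F x. ereal (norm (prox_grad_mapping \<gamma> h x g))) \<le> ereal \<epsilon>"

definition frank_wolfe_gap :: "('a::euclidean_space \<Rightarrow> ereal) \<Rightarrow> 'a \<Rightarrow> 'a \<Rightarrow> ereal" where
  "frank_wolfe_gap h x g = (SUP y. h x - h y + ereal ((y - x) \<bullet> (- g)))"

definition CGGSP ::
  "('a::euclidean_space \<Rightarrow> real) \<Rightarrow> ('a \<Rightarrow> ereal) \<Rightarrow> real \<Rightarrow> 'a \<Rightarrow> bool" where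
  "CGGSP F h \<epsilon> x \<longleftrightarrow> (INF g\<in>clarke_subdiff F x. frank_wolfe_gap h x g) \<le> ereal \<epsilon>"

definition local_oracle ::
  "(('a::euclidean_space \<Rightarrow> real) \<Rightarrow> ('a \<Rightarrow> ereal) \<Rightarrow> 'a \<Rightarrow> 'o) \<Rightarrow> bool" where
  "local_oracle Orc \<longleftrightarrow>
     (\<forall>F F' h h' x. admissible F h \<and> admissible F' h' \<and>
        (\<forall>\<^sub>F y in nhds x. F y = F' y \<and> h y = h' y) \<longrightarrow> Orc F h x = Orc F' h' x)"

text \<open>An algorithm maps its internal randomness \<open>\<omega>\<close> and the list of oracle answers received so far
  (oldest first) to the next point. Indices start at 0: \<open>iterate alg q \<omega> t\<close> is the point
  \<open>x\<^sub>t\<^sub>+\<^sub>1\<close>, chosen after \<open>t\<close> answers of the oracle \<open>q\<close>.\<close>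

primrec answers :: "('w \<Rightarrow> 'o list \<Rightarrow> 'a) \<Rightarrow> ('a \<Rightarrow> 'o) \<Rightarrow> 'w \<Rightarrow> nat \<Rightarrow> 'o list" where
  "answers alg q \<omega> 0 = []"
| "answers alg q \<omega> (Suc t) =
     answers alg q \<omega> t @ [q (alg \<omega> (answers alg q \<omega> t))]"

definition iterate :: "('w \<Rightarrow> 'o list \<Rightarrow> 'a) \<Rightarrow> ('a \<Rightarrow> 'o) \<Rightarrow> 'w \<Rightarrow> nat \<Rightarrow> 'a" where
  "iterate alg q \<omega> t = alg \<omega> (answers alg q \<omega> t)"

text \<open>No \<open>\<sigma>\<close>-algebra is imposed on the answers; it is only required that, on every problem instance,
  the generated points are random variables.\<close>

definition randomized_algorithm ::
  "'w measure \<Rightarrow> (('a::euclidean_space \<Rightarrow> real) \<Rightarrow> ('a \<Rightarrow> ereal) \<Rightarrow> 'a \<Rightarrow> 'o) \<Rightarrow> nat \<Rightarrow>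
     ('w \<Rightarrow> 'o list \<Rightarrow> 'a) \<Rightarrow> bool" where
  "randomized_algorithm M Orc T alg \<longleftrightarrow>
     prob_space M \<and>
     (\<forall>F h. admissible F h \<longrightarrow>
        (\<forall>t<T. (\<lambda>\<omega>. iterate alg (Orc F h) \<omega> t) \<in> borel_measurable M))"

end

theory Submission
  imports Defs
begin

text \<open>
  The regularizer is \<open>h = 0\<close>, and \<open>F\<close> depends on a single coordinate \<open>y = x \<bullet> e\<close>. Along it \<open>F\<close> has
  slope \<open>-1\<close> up to a hidden point \<open>p \<in> [0, 1]\<close>, climbs a steep cliff just to the right of \<open>p\<close>, and
  from the top of the cliff on it is the identity. The gap \<open>F 0 - inf F = p\<close> is at most 1, and
  all Clarke subgradients off the hyperplane \<open>y = p\<close> have norm at least 1. With \<open>h = 0\<close> the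
  proximal gradient mapping is the subgradient itself and the Frank-Wolfe gap of a subgradient \<open>g\<close> is
  at least \<open>(norm g)\<^sup>2\<close>, so the stationary points are exactly the points of that hyperplane
  (\<open>ridge_stationary_iff\<close>).

  The germ of \<open>F\<close> at a point left of the cliff is that of \<open>- y\<close>, and right of the cliff that of \<open>y\<close>.
  Hence a local oracle queried off the cliff discloses one bit, namely the side on which the cliff lies:
  linear germs with a common intercept carry no information about \<open>p\<close>, because it is the cliff that
  absorbs the difference of their values. As long as an algorithm misses the cliff, it can do no
  better than a binary search. For fixed internal randomness its runs with \<open>T\<close> queries against all
  possible cliffs therefore meet a cliff for the first time in a set of at most \<open>T * 2 ^ T\<close>
  points, and so hit at most that many out of \<open>N\<close> pairwise disjoint cliffs (\<open>card_hit_holes_le\<close>).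
  By averaging over the cliffs, one of them is hit with probability at most \<open>T * 2 ^ T / N\<close>
  (\<open>exists_rare_event\<close>). The number \<open>N\<close> is free, at the expense of a Lipschitz constant that
  grows linearly in \<open>N\<close>; taking \<open>N\<close> at least \<open>2 ^ T * exp (d / 36)\<close> gives the bound.
\<close>

section \<open>A one-dimensional valley next to a cliff\<close>

text \<open>For \<open>K \<ge> 1\<close> and \<open>p \<ge> 0\<close>, this is \<open>- y\<close> up to \<open>p\<close>, followed by a cliff of slope \<open>K\<close> that starts at
  the point \<open>(p, - p)\<close> and is cut off where it meets the diagonal. Writing it with \<open>max\<close> and \<open>min\<close>
  makes the Lipschitz bound immediate.\<close>

definition valley :: "real \<Rightarrow> real \<Rightarrow> real \<Rightarrow> real" where
  "valley K p y = max (- y) (min y (K * (y - p) - p))"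

lemma valley_left:
  assumes "K \<ge> 1" "y \<le> p"
  shows "valley K p y = - y"
proof -
  have "K * (y - p) \<le> 1 * (y - p)"
    using assms by (intro mult_right_mono_neg) auto
  then show ?thesis
    using assms unfolding valley_def by (auto simp: max_def min_def)
qed

lemma valley_right:
  assumes "K \<ge> 1" "0 \<le> p" "p \<le> y"
  shows "valley K p y = min y (K * (y - p) - p)"
proof -
  have "0 \<le> K * (y - p)" using assms by auto
  then show ?thesis
    using assms unfolding valley_def by (intro max_absorb2 min.boundedI) linarith+
qed

lemma valley_beyond_cliff:
  assumes "K \<ge> 1" "0 \<le> p" "p \<le> y" "2 * p \<le> (K - 1) * (y - p)"
  shows "valley K p y = y"
  using assms by (simp add: valley_right algebra_simps)

text \<open>A single estimate covers the cliff, its top and the far slope: right of \<open>p\<close> the function is the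
  minimum of two lines of slope at least 1. This is what rules out stationary points there,
  the kink at the top of the cliff included.\<close>

lemma valley_growth:
  assumes "K \<ge> 1" "0 \<le> p" "p \<le> a" "a \<le> b"
  shows "valley K p a + (b - a) \<le> valley K p b"
proof -
  have "1 * (b - a) \<le> K * (b - a)" using assms by (intro mult_right_mono) auto
  then have "K * (a - p) + (b - a) \<le> K * (b - p)" by (simp add: algebra_simps)
  then show ?thesis using assms by (simp add: valley_right)
qed

lemma valley_minimum:
  assumes "K \<ge> 1" "0 \<le> p"
  shows "- p \<le> valley K p y" "valley K p p = - p"
proof -
  show min: "valley K p p = - p" using assms by (simp add: valley_left)
  show "- p \<le> valley K p y"
    using assms valley_left[of K y p] valley_growth[of K p p y] min by (cases "y \<le> p") auto
qed

lemma valley_lipschitz: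
  assumes "K \<ge> 1"
  shows "\<bar>valley K p a - valley K p b\<bar> \<le> K * \<bar>a - b\<bar>"
proof -
  have 1: "\<bar>a - b\<bar> \<le> K * \<bar>a - b\<bar>" using assms mult_right_mono[of 1 K "\<bar>a - b\<bar>"] by simp
  have 2: "\<bar>(K * (a - p) - p) - (K * (b - p) - p)\<bar> = K * \<bar>a - b\<bar>"
    using assms by (simp add: abs_mult flip: right_diff_distrib)
  have max: "\<bar>max u v - max u' v'\<bar> \<le> m" and min: "\<bar>min u v - min u' v'\<bar> \<le> m"
    if "\<bar>u - u'\<bar> \<le> m" "\<bar>v - v'\<bar> \<le> m" for u v u' v' m :: real
    using that by linarith+
  show ?thesis
    unfolding valley_def using 1 2 by (intro max min) auto
qed

section \<open>Stationarity without a regularizer\<close>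

text \<open>A deterministic function is an expectation under a point mass. The constant \<open>C + 1\<close> serves for
  \<open>L\<close> and \<open>G\<close>, which have to be positive even when \<open>C = 0\<close>.\<close>

lemma expected_lipschitzI:
  assumes "C-lipschitz_on UNIV F"
  shows "expected_lipschitz F"
proof -
  interpret P: prob_space "return borel (0::real)" by (rule prob_space_return) simp
  have C: "C \<ge> 0" using assms by (rule lipschitz_on_nonneg)
  have "(C + 1)-lipschitz_on UNIV F" using assms by (rule lipschitz_on_mono) auto
  then show ?thesis
    unfolding expected_lipschitz_def using C
    by (intro exI[of _ "return borel (0::real)"] exI[of _ "\<lambda>_. F"] exI[of _ "\<lambda>_. C + 1"]
        exI[of _ "C + 1"]) (simp add: P.prob_space_axioms P.prob_space[simplified])
qed

lemma proper_closed_convex_zero: "proper_closed_convex (\<lambda>_::'a::euclidean_space. 0)"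
proof -
  have "ereal_epigraph (\<lambda>_::'a. 0) = UNIV \<times> {0..}"
    by (auto simp: ereal_epigraph_def)
  then show ?thesis
    unfolding proper_closed_convex_def by (simp add: closed_Times convex_Times)
qed

lemma prox_zero:
  fixes x :: "'a::euclidean_space"
  assumes "\<gamma> > 0"
  shows "prox \<gamma> (\<lambda>_. 0) x = x"
  unfolding prox_def
proof (rule arg_minI[where x = x])
  fix z :: 'a
  assume "\<forall>y. True \<longrightarrow>
    \<not> (0 + ereal (1 / (2 * \<gamma>) * (norm (y - x))\<^sup>2) < 0 + ereal (1 / (2 * \<gamma>) * (norm (z - x))\<^sup>2))"
  from spec[OF this, of x] show "z = x"
    using assms by (auto simp: divide_less_0_iff zero_less_divide_iff not_less)
next
  fix y
  have "0 \<le> 1 / (2 * \<gamma>) * (norm (y - x))\<^sup>2" using assms by simp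
  then show "\<not> 0 + ereal (1 / (2 * \<gamma>) * (norm (y - x))\<^sup>2)
      < 0 + ereal (1 / (2 * \<gamma>) * (norm (x - x))\<^sup>2)"
    by (simp add: not_less zero_ereal_def)
qed simp

lemma prox_grad_mapping_zero:
  assumes "\<gamma> > 0"
  shows "prox_grad_mapping \<gamma> (\<lambda>_. 0) x g = g"
  using assms by (simp add: prox_grad_mapping_def prox_zero)

text \<open>If moving along the unit vector \<open>v\<close> lowers \<open>F\<close> at rate at least 1 from every point near \<open>x\<close>, then
  the Clarke derivative at \<open>x\<close> along \<open>v\<close> is at most \<open>-1\<close>, hence so is \<open>g \<bullet> v\<close>. The descent has to be
  uniform near \<open>x\<close>, since the Clarke derivative also moves the base point.\<close>

lemma clarke_subgradient_norm_ge_1: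
  fixes v :: "'a::euclidean_space"
  assumes g: "g \<in> clarke_subdiff F x"
    and v: "norm v = 1"
    and U: "open U" "x \<in> U"
    and s: "s > 0"
    and desc: "\<And>y t. y \<in> U \<Longrightarrow> 0 < t \<Longrightarrow> t < s \<Longrightarrow> F (y + t *\<^sub>R v) + t \<le> F y"
  shows "norm g \<ge> 1"
proof -
  have "eventually (\<lambda>y. y \<in> U) (nhds x)" using U by (rule eventually_nhds_in_open)
  moreover have "eventually (\<lambda>t. 0 < t \<and> t < s) (at_right 0)"
    using s by (auto intro!: eventually_conj eventually_at_right_less
        simp: eventually_at_right_field)
  ultimately have "eventually (\<lambda>(y, t). y \<in> U \<and> 0 < t \<and> t < s) (nhds x \<times>\<^sub>F at_right 0)"
    using eventually_prodI[of "\<lambda>y. y \<in> U" "nhds x" "\<lambda>t. 0 < t \<and> t < s" "at_right 0"]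
    by (simp add: case_prod_unfold)
  then have "eventually (\<lambda>(y, t). ereal ((F (y + t *\<^sub>R v) - F y) / t) \<le> ereal (- 1))
      (nhds x \<times>\<^sub>F at_right 0)"
  proof eventually_elim
    case (elim yt)
    then show ?case using desc[of "fst yt" "snd yt"]
      by (auto simp: case_prod_unfold divide_le_eq)
  qed
  then have "clarke_dir_deriv F x v \<le> ereal (- 1)"
    unfolding clarke_dir_deriv_def by (intro Limsup_bounded) (simp add: case_prod_unfold)
  moreover have "ereal (g \<bullet> v) \<le> clarke_dir_deriv F x v"
    using g by (simp add: clarke_subdiff_def)
  ultimately have "ereal (g \<bullet> v) \<le> ereal (- 1)" by (rule order_trans[rotated])
  then have "1 \<le> \<bar>g \<bullet> v\<bar>" by simp
  also have "\<dots> \<le> norm g" using Cauchy_Schwarz_ineq2[of g v] v by simp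
  finally show ?thesis .
qed

text \<open>The upper limit over nearby base points is at least the upper limit with the base point fixed
  at \<open>x\<close>, whose difference quotients are nonnegative. (Because \<open>nhds x\<close> is not punctured, it
  contains \<open>x\<close> itself.)\<close>

lemma zero_in_clarke_subdiff_at_minimum:
  assumes "\<And>y. F x \<le> F y"
  shows "0 \<in> clarke_subdiff F x"
proof -
  have "0 \<le> clarke_dir_deriv F x v" for v
  proof (rule ccontr)
    assume "\<not> 0 \<le> clarke_dir_deriv F x v"
    then have "Limsup (nhds x \<times>\<^sub>F at_right 0) (\<lambda>(y, t). ereal ((F (y + t *\<^sub>R v) - F y) / t)) < 0"
      by (simp add: clarke_dir_deriv_def not_le)
    then have "eventually (\<lambda>(y, t). ereal ((F (y + t *\<^sub>R v) - F y) / t) < 0)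
        (nhds x \<times>\<^sub>F at_right 0)"
      by (drule_tac Limsup_lessD) (simp add: case_prod_unfold)
    then obtain P Q where "eventually P (nhds x)" "eventually Q (at_right (0::real))"
      and PQ: "\<And>y t. P y \<Longrightarrow> Q t \<Longrightarrow> (F (y + t *\<^sub>R v) - F y) / t < 0"
      unfolding eventually_prod_filter by auto
    moreover have "eventually (\<lambda>t::real. 0 < t) (at_right 0)"
      by (rule eventually_at_right_less)
    ultimately have "P x" "eventually (\<lambda>t. Q t \<and> 0 < t) (at_right (0::real))"
      by (auto intro: eventually_nhds_x_imp_x eventually_conj)
    moreover from this(2) obtain t where "Q t" "0 < t"
      using eventually_happens'[OF trivial_limit_at_right_real] by blast
    ultimately have "F (x + t *\<^sub>R v) < F x"
      using PQ[of x t] by (simp add: divide_less_0_iff)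
    then show False using assms[of "x + t *\<^sub>R v"] by simp
  qed
  then show ?thesis by (simp add: clarke_subdiff_def zero_ereal_def)
qed

lemma not_PGSP_zero:
  assumes "\<And>g. g \<in> clarke_subdiff F x \<Longrightarrow> norm g \<ge> 1" "\<gamma> > 0" "\<epsilon> < 1"
  shows "\<not> PGSP F (\<lambda>_. 0) \<gamma> \<epsilon> x"
proof -
  have "ereal 1 \<le> (INF g\<in>clarke_subdiff F x. ereal (norm (prox_grad_mapping \<gamma> (\<lambda>_. 0) x g)))"
    using assms by (intro INF_greatest) (simp add: prox_grad_mapping_zero)
  then show ?thesis using assms(3) unfolding PGSP_def
    by (metis dual_order.trans ereal_less_eq(3) not_le)
qed

text \<open>Without a regularizer the gap is the supremum of \<open>(y - x) \<bullet> (- g)\<close>, and the competitor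
  \<open>y = x - g\<close> already yields \<open>(norm g)\<^sup>2\<close>.\<close>

lemma not_CGGSP_zero:
  assumes "\<And>g. g \<in> clarke_subdiff F x \<Longrightarrow> norm g \<ge> 1" "\<epsilon> < 1"
  shows "\<not> CGGSP F (\<lambda>_. 0) \<epsilon> x"
proof -
  have "ereal 1 \<le> frank_wolfe_gap (\<lambda>_. 0) x g" if "g \<in> clarke_subdiff F x" for g
  proof -
    have "1 \<le> (norm g)\<^sup>2" using assms(1)[OF that] by simp
    then have "ereal 1 \<le> 0 - 0 + ereal ((x - g - x) \<bullet> (- g))"
      by (simp add: power2_norm_eq_inner)
    also have "\<dots> \<le> frank_wolfe_gap (\<lambda>_. 0) x g"
      unfolding frank_wolfe_gap_def by (rule SUP_upper) simp
    finally show ?thesis .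
  qed
  then have "ereal 1 \<le> (INF g\<in>clarke_subdiff F x. frank_wolfe_gap (\<lambda>_. 0) x g)"
    by (rule INF_greatest)
  then show ?thesis using assms(2) unfolding CGGSP_def
    by (metis dual_order.trans ereal_less_eq(3) not_le)
qed

lemma PGSP_zero_at_minimum:
  assumes "\<And>y. F x \<le> F y" "\<gamma> > 0" "\<epsilon> \<ge> 0"
  shows "PGSP F (\<lambda>_. 0) \<gamma> \<epsilon> x"
proof -
  have "(INF g\<in>clarke_subdiff F x. ereal (norm (prox_grad_mapping \<gamma> (\<lambda>_. 0) x g)))
      \<le> ereal (norm (prox_grad_mapping \<gamma> (\<lambda>_. 0) x 0))"
    by (rule INF_lower) (rule zero_in_clarke_subdiff_at_minimum[of F, OF assms(1)])
  also have "\<dots> \<le> ereal \<epsilon>" using assms by (simp add: prox_grad_mapping_zero)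
  finally show ?thesis by (simp add: PGSP_def)
qed

section \<open>The hard functions\<close>

text \<open>For a unit vector \<open>e\<close>, \<open>K \<ge> 1\<close> and \<open>p \<ge> 0\<close>, the minimizers form the hyperplane \<open>x \<bullet> e = p\<close>.\<close>

definition ridge :: "'a::euclidean_space \<Rightarrow> real \<Rightarrow> real \<Rightarrow> 'a \<Rightarrow> real" where
  "ridge e K p x = valley K p (x \<bullet> e)"

lemma expected_lipschitz_ridge:
  assumes "norm e = 1" "K \<ge> 1"
  shows "expected_lipschitz (ridge e K p)"
proof (rule expected_lipschitzI[of K], rule lipschitz_onI)
  fix x y
  have "\<bar>x \<bullet> e - y \<bullet> e\<bar> \<le> norm (x - y)"
    using Cauchy_Schwarz_ineq2[of "x - y" e] assms by (simp add: inner_diff_left)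
  then have "K * \<bar>x \<bullet> e - y \<bullet> e\<bar> \<le> K * norm (x - y)"
    using assms by (intro mult_left_mono) auto
  with valley_lipschitz[OF assms(2), of p "x \<bullet> e" "y \<bullet> e"]
  show "dist (ridge e K p x) (ridge e K p y) \<le> K * dist x y"
    by (simp add: ridge_def dist_real_def dist_norm)
qed (use assms in auto)

lemma expected_lipschitz_inner: "expected_lipschitz (\<lambda>x. x \<bullet> a)"
proof (rule expected_lipschitzI[of "norm a"], rule lipschitz_onI)
  fix x y
  show "dist (x \<bullet> a) (y \<bullet> a) \<le> norm a * dist x y"
    using Cauchy_Schwarz_ineq2[of "x - y" a]
    by (simp add: inner_diff_left dist_real_def dist_norm mult.commute)
qed auto

text \<open>Left of \<open>p\<close> the descent direction is \<open>e\<close>, right of \<open>p\<close> it is \<open>- e\<close>. Base points that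
  stay half the distance \<open>\<bar>x \<bullet> e - p\<bar>\<close> away from \<open>p\<close> and steps shorter than that half never cross
  \<open>p\<close>.\<close>

lemma ridge_subgradient_norm_ge_1:
  assumes e: "norm e = 1" and K: "K \<ge> 1" and p: "0 \<le> p"
    and x: "x \<bullet> e \<noteq> p" and g: "g \<in> clarke_subdiff (ridge e K p) x"
  shows "norm g \<ge> 1"
proof -
  have ee: "e \<bullet> e = 1" using e by (simp add: norm_eq_1)
  define s where "s = \<bar>x \<bullet> e - p\<bar> / 2"
  have s: "s > 0" using x by (simp add: s_def)
  have cont: "continuous_on UNIV (\<lambda>y. y \<bullet> e)" by (intro continuous_intros)
  show ?thesis
  proof (cases "x \<bullet> e < p")
    case True
    have "open {y. y \<bullet> e < p - s}" by (rule open_Collect_less[OF cont]) auto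
    then show ?thesis
    proof (rule clarke_subgradient_norm_ge_1[OF g e _ _ s])
      show "x \<in> {y. y \<bullet> e < p - s}" using True by (simp add: s_def field_simps)
    next
      fix y t assume "y \<in> {y. y \<bullet> e < p - s}" "0 < t" "t < s"
      then show "ridge e K p (y + t *\<^sub>R e) + t \<le> ridge e K p y"
        using valley_left[OF K, of "y \<bullet> e + t"] valley_left[OF K, of "y \<bullet> e"]
        by (simp add: ridge_def inner_add_left ee)
    qed
  next
    case False
    have "open {y. p + s < y \<bullet> e}" by (rule open_Collect_less[OF _ cont]) auto
    then show ?thesis
    proof (rule clarke_subgradient_norm_ge_1[OF g, of "- e", rotated])
      show "x \<in> {y. p + s < y \<bullet> e}" using False x by (simp add: s_def field_simps)
    next
      fix y t assume "y \<in> {y. p + s < y \<bullet> e}" "0 < t" "t < s"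
      then show "ridge e K p (y + t *\<^sub>R (- e)) + t \<le> ridge e K p y"
        using valley_growth[OF K p, of "y \<bullet> e - t" "y \<bullet> e"]
        by (simp add: ridge_def inner_diff_left ee)
    qed (use e s in auto)
  qed
qed

text \<open>Excluding stationarity off the hyperplane gives the lower bound. The converse is needed as well:
  it identifies the event that no iterate is stationary with a condition on the real numbers
  \<open>x\<^sub>t \<bullet> e\<close>, and only this makes the event measurable.\<close>

lemma ridge_stationary_iff:
  assumes "norm e = 1" "K \<ge> 1" "0 \<le> p"
  shows "(\<forall>\<epsilon>\<in>{0<..<1 / (4 * sqrt 2)}. \<forall>\<gamma>\<in>{0<..1 / 10}.
      \<not> PGSP (ridge e K p) (\<lambda>_. 0) \<gamma> \<epsilon> x \<and> \<not> CGGSP (ridge e K p) (\<lambda>_. 0) \<epsilon> x)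
    \<longleftrightarrow> x \<bullet> e \<noteq> p" (is "?L \<longleftrightarrow> _")
proof
  assume "x \<bullet> e \<noteq> p"
  note ge1 = ridge_subgradient_norm_ge_1[OF assms this]
  have "1 / (4 * sqrt 2) < (1::real)" by (simp add: real_less_rsqrt less_1_mult)
  then show ?L
    by (intro ballI conjI not_PGSP_zero not_CGGSP_zero ge1)
      (auto intro: less_trans)
next
  assume L: ?L
  show "x \<bullet> e \<noteq> p"
  proof
    assume "x \<bullet> e = p"
    then have min: "ridge e K p x \<le> ridge e K p y" for y
      using valley_minimum[OF assms(2,3)] by (simp add: ridge_def)
    have "PGSP (ridge e K p) (\<lambda>_. 0) (1 / 10) (1 / (8 * sqrt 2)) x"
      by (rule PGSP_zero_at_minimum) (auto intro: min)
    moreover have "1 / (8 * sqrt 2) \<in> {0<..<1 / (4 * sqrt 2 :: real)}" "1 / 10 \<in> {0<..1 / 10 :: real}"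
      by (auto simp: field_simps)
    ultimately show False using L by blast
  qed
qed

section \<open>Few points are reachable by two-valued answers\<close>

text \<open>The lists of \<open>t\<close> answers that the algorithm can receive when each answer is given by one of two
  fixed oracles: the levels of a binary tree, which does not depend on the instance.\<close>

primrec transcripts ::
  "('w \<Rightarrow> 'o list \<Rightarrow> 'a) \<Rightarrow> ('a \<Rightarrow> 'o) \<Rightarrow> ('a \<Rightarrow> 'o) \<Rightarrow> 'w \<Rightarrow> nat \<Rightarrow> 'o list set" where
  "transcripts alg q0 q1 \<omega> 0 = {[]}"
| "transcripts alg q0 q1 \<omega> (Suc t) =
     (\<lambda>a. a @ [q0 (alg \<omega> a)]) ` transcripts alg q0 q1 \<omega> t \<union>
     (\<lambda>a. a @ [q1 (alg \<omega> a)]) ` transcripts alg q0 q1 \<omega> t"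

lemma transcripts_card:
  "finite (transcripts alg q0 q1 \<omega> t) \<and> card (transcripts alg q0 q1 \<omega> t) \<le> 2 ^ t"
proof (induction t)
  case (Suc t)
  let ?S = "transcripts alg q0 q1 \<omega> t"
  have "card (transcripts alg q0 q1 \<omega> (Suc t)) \<le> card ?S + card ?S"
    using Suc by (auto intro!: order_trans[OF card_Un_le] add_mono card_image_le)
  then show ?case using Suc by auto
qed simp

lemma answers_in_transcripts:
  assumes "\<And>s. s < t \<Longrightarrow> q (iterate alg q \<omega> s) \<in> {q0 (iterate alg q \<omega> s), q1 (iterate alg q \<omega> s)}"
  shows "answers alg q \<omega> t \<in> transcripts alg q0 q1 \<omega> t"
  using assms
proof (induction t)
  case (Suc t)
  then have "answers alg q \<omega> t \<in> transcripts alg q0 q1 \<omega> t" by simp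
  moreover have "q (alg \<omega> (answers alg q \<omega> t)) \<in>
      {q0 (alg \<omega> (answers alg q \<omega> t)), q1 (alg \<omega> (answers alg q \<omega> t))}"
    using Suc.prems[of t] by (simp add: iterate_def)
  ultimately show ?case by auto
qed simp

text \<open>Instance \<open>i\<close> differs from the two reference oracles only inside its hole \<open>H i\<close>. Up to the first visit
  to the hole, the run on instance \<open>i\<close> follows a branch of the binary tree, so the point of the first visit
  is one of the at most \<open>T * 2 ^ T\<close> points that the tree generates. Disjointness of the holes turns a
  bound on the points into a bound on the instances.\<close>

lemma card_hit_holes_le:
  fixes q :: "'i \<Rightarrow> 'a \<Rightarrow> 'o"
  assumes out: "\<And>i x. i \<in> I \<Longrightarrow> x \<notin> H i \<Longrightarrow> q i x \<in> {q0 x, q1 x}"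
    and disj: "disjoint_family_on H I"
  shows "card {i \<in> I. \<exists>t<T. iterate alg (q i) \<omega> t \<in> H i} \<le> T * 2 ^ T"
proof -
  define X where "X = (\<Union>t<T. alg \<omega> ` transcripts alg q0 q1 \<omega> t)"
  have finX: "finite X" unfolding X_def by (intro finite_UN_I finite_imageI) (auto simp: transcripts_card)
  have "card X \<le> (\<Sum>t<T. card (alg \<omega> ` transcripts alg q0 q1 \<omega> t))"
    unfolding X_def by (rule card_UN_le) simp
  also have "\<dots> \<le> (\<Sum>t<T. 2 ^ T)"
  proof (rule sum_mono)
    fix t assume "t \<in> {..<T}"
    then have "(2::nat) ^ t \<le> 2 ^ T" by (intro power_increasing) auto
    then show "card (alg \<omega> ` transcripts alg q0 q1 \<omega> t) \<le> 2 ^ T"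
      using transcripts_card[of alg q0 q1 \<omega> t] card_image_le[of "transcripts alg q0 q1 \<omega> t" "alg \<omega>"]
      by linarith
  qed
  finally have cardX: "card X \<le> T * 2 ^ T" by simp
  have hit: "\<exists>x\<in>X. x \<in> H i"
    if i: "i \<in> I" and t: "t < T" "iterate alg (q i) \<omega> t \<in> H i" for i t
  proof -
    \<comment> \<open>Later points may depend on what was learned in the hole, so only the first visit is
      controlled.\<close>
    define t0 where "t0 = (LEAST t. iterate alg (q i) \<omega> t \<in> H i)"
    have t0: "iterate alg (q i) \<omega> t0 \<in> H i" "t0 \<le> t"
      unfolding t0_def by (rule LeastI[of _ t], rule t(2)) (rule Least_le, rule t(2))
    have "iterate alg (q i) \<omega> s \<notin> H i" if "s < t0" for s
      using that unfolding t0_def by (rule not_less_Least)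
    then have "answers alg (q i) \<omega> t0 \<in> transcripts alg q0 q1 \<omega> t0"
      by (rule answers_in_transcripts[OF out[OF i]])
    then have "iterate alg (q i) \<omega> t0 \<in> X"
      unfolding X_def iterate_def using t t0 by auto
    then show ?thesis using t0 by blast
  qed
  define J where "J = {i \<in> I. \<exists>t<T. iterate alg (q i) \<omega> t \<in> H i}"
  have "\<forall>i\<in>J. \<exists>x. x \<in> X \<and> x \<in> H i"
    using hit by (auto simp: J_def)
  then obtain pick where pick: "\<forall>i\<in>J. pick i \<in> X \<and> pick i \<in> H i"
    by (rule bchoice[THEN exE])
  have "inj_on pick J"
  proof (rule inj_onI, rule ccontr)
    fix i j assume "i \<in> J" "j \<in> J" "pick i = pick j" "i \<noteq> j"
    moreover from this have "H i \<inter> H j = {}"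
      using disj by (simp add: disjoint_family_on_def J_def)
    ultimately show False using pick by (metis disjoint_iff)
  qed
  then have "card J \<le> card X"
    using pick finX by (intro card_inj_on_le[of pick]) auto
  then show ?thesis using cardX by (simp add: J_def)
qed

text \<open>Double counting: the probabilities of the events add up to the expected number of events that occur.\<close>

lemma (in prob_space) exists_rare_event:
  assumes I: "finite I" "I \<noteq> {}"
    and B: "\<And>i. i \<in> I \<Longrightarrow> B i \<in> events"
    and m: "\<And>\<omega>. \<omega> \<in> space M \<Longrightarrow> card {i \<in> I. \<omega> \<in> B i} \<le> m"
  shows "\<exists>i\<in>I. prob (B i) \<le> m / card I"
proof (rule ccontr)
  assume "\<not> ?thesis"
  then have "m / card I < prob (B i)" if "i \<in> I" for i using that by (auto simp: not_le)
  then have "(\<Sum>i\<in>I. m / card I) < (\<Sum>i\<in>I. prob (B i))" using I by (intro sum_strict_mono) auto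
  then have "m < (\<Sum>i\<in>I. prob (B i))" using I by simp
  also have "\<dots> = (\<Sum>i\<in>I. expectation (indicator (B i)))"
    using B by (intro sum.cong) auto
  also have "\<dots> = expectation (\<lambda>\<omega>. \<Sum>i\<in>I. indicator (B i) \<omega>)"
    using B by (intro Bochner_Integration.integral_sum[symmetric]) (auto simp: emeasure_eq_measure)
  also have "\<dots> \<le> expectation (\<lambda>_. m)"
  proof (rule integral_mono)
    show "integrable M (\<lambda>\<omega>. \<Sum>i\<in>I. indicator (B i) \<omega> :: real)"
      using B by (intro Bochner_Integration.integrable_sum) (auto simp: emeasure_eq_measure)
    fix \<omega> assume "\<omega> \<in> space M"
    have "(\<Sum>i\<in>I. indicator (B i) \<omega> :: real) = card {i \<in> I. \<omega> \<in> B i}"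
      using I by (simp add: indicator_def sum.If_cases Int_def)
    then show "(\<Sum>i\<in>I. indicator (B i) \<omega>) \<le> real m" using m[OF \<open>\<omega> \<in> space M\<close>] by simp
  qed simp
  finally show False by (simp add: prob_space)
qed

section \<open>The lower bound\<close>

theorem theorem1:
  fixes T :: nat
    and M :: "'w measure"
    and Orc :: "(real^'n \<Rightarrow> real) \<Rightarrow> (real^'n \<Rightarrow> ereal) \<Rightarrow> real^'n \<Rightarrow> 'o"
    and alg :: "'w \<Rightarrow> 'o list \<Rightarrow> real^'n"
  assumes "CARD('n) \<ge> 2"
    and "local_oracle Orc"
    and "randomized_algorithm M Orc T alg"
  shows "\<exists>(F :: real^'n \<Rightarrow> real) (h :: real^'n \<Rightarrow> ereal).
    expected_lipschitz F \<and> proper_closed_convex h \<and>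
    objective F h 0 - (INF x. objective F h x) \<le> 2 \<and>
    \<P>(\<omega> in M. \<forall>\<epsilon>\<in>{0<..<1 / (4 * sqrt 2)}. \<forall>\<gamma>\<in>{0<..1 / 10}. \<forall>t<T.
        \<not> PGSP F h \<gamma> \<epsilon> (iterate alg (Orc F h) \<omega> t) \<and>
        \<not> CGGSP F h \<epsilon> (iterate alg (Orc F h) \<omega> t))
      \<ge> 1 - 2 * real T * exp (- real CARD('n) / 36)"
proof -
  interpret prob_space M using assms(3) by (simp add: randomized_algorithm_def)
  define e :: "real^'n" where "e = axis undefined 1"
  have e: "norm e = 1" by (simp add: e_def)
  define N where "N = nat \<lceil>2 ^ T * exp (real CARD('n) / 36)\<rceil>"
  have N: "2 ^ T * exp (real CARD('n) / 36) \<le> N" by (simp add: N_def of_nat_ceiling)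
  moreover have "0 < 2 ^ T * exp (real CARD('n) / 36)" by simp
  ultimately have "real N > 0" by linarith
  then have Npos: "N > 0" by simp
  \<comment> \<open>The cliffs start at \<open>i / N\<close> for \<open>i < N\<close> and occupy half of the space up to the next one, which
    makes the closed holes disjoint. Over the width \<open>1 / (2 * N)\<close>, the slope \<open>1 + 4 * N\<close> gains \<open>2\<close> on the
    diagonal; the climb from \<open>- p\<close> to the diagonal requires \<open>2 * p\<close>, and \<open>p \<le> 1\<close>.\<close>
  define K where "K = 1 + 4 * real N"
  have K: "K \<ge> 1" by (simp add: K_def)
  define F where "F i = ridge e K (real i / N)" for i
  define q where "q i = Orc (F i) (\<lambda>_. 0)" for i
  define H where "H i = {x. real i / N \<le> x \<bullet> e \<and> x \<bullet> e \<le> real i / N + 1 / (2 * N)}" for i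
  have adm: "admissible (F i) (\<lambda>_. 0)" for i
    by (simp add: F_def admissible_def expected_lipschitz_ridge[OF e K] proper_closed_convex_zero)
  have adm_inner: "admissible (\<lambda>x::real^'n. x \<bullet> a) (\<lambda>_. 0)" for a
    by (simp add: admissible_def expected_lipschitz_inner proper_closed_convex_zero)
  have cont: "continuous_on UNIV (\<lambda>y::real^'n. y \<bullet> e)" by (intro continuous_intros)

  have out: "q i x \<in> {Orc (\<lambda>x. x \<bullet> (- e)) (\<lambda>_. 0) x, Orc (\<lambda>x. x \<bullet> e) (\<lambda>_. 0) x}"
    if "i \<in> {..<N}" "x \<notin> H i" for i x
  proof -
    from that have p: "0 \<le> real i / N" "real i / N \<le> 1" by auto
    consider "x \<bullet> e < real i / N" | "real i / N + 1 / (2 * N) < x \<bullet> e"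
      using \<open>x \<notin> H i\<close> by (auto simp: H_def)
    then show ?thesis
    proof cases
      case 1
      have "open {y. y \<bullet> e < real i / N}" by (rule open_Collect_less[OF cont]) auto
      then have "\<forall>\<^sub>F y in nhds x. y \<in> {y. y \<bullet> e < real i / N}"
        by (rule eventually_nhds_in_open) (use 1 in simp)
      then have "\<forall>\<^sub>F y in nhds x. F i y = y \<bullet> (- e) \<and> (0::ereal) = 0"
        by eventually_elim (simp add: F_def ridge_def valley_left[OF K])
      then have "q i x = Orc (\<lambda>x. x \<bullet> (- e)) (\<lambda>_. 0) x"
        using assms(2) adm adm_inner unfolding local_oracle_def q_def by blast
      then show ?thesis by blast
    next
      case 2
      have "open {y. real i / N + 1 / (2 * N) < y \<bullet> e}" by (rule open_Collect_less[OF _ cont]) auto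
      then have "\<forall>\<^sub>F y in nhds x. y \<in> {y. real i / N + 1 / (2 * N) < y \<bullet> e}"
        by (rule eventually_nhds_in_open) (use 2 in simp)
      then have "\<forall>\<^sub>F y in nhds x. F i y = y \<bullet> e \<and> (0::ereal) = 0"
      proof eventually_elim
        case (elim y)
        have "(K - 1) * (1 / (2 * N)) = 2" using Npos by (simp add: K_def)
        then have "2 * (real i / N) \<le> (K - 1) * (1 / (2 * N))" using p(2) by linarith
        also have "\<dots> \<le> (K - 1) * (y \<bullet> e - real i / N)"
          using elim K by (intro mult_left_mono) auto
        finally have "2 * (real i / N) \<le> (K - 1) * (y \<bullet> e - real i / N)" .
        moreover have "real i / N \<le> y \<bullet> e"
          using elim by (auto intro: order_trans[rotated, OF less_imp_le])
        ultimately show ?case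
          using valley_beyond_cliff[OF K p(1)] by (simp add: F_def ridge_def)
      qed
      then have "q i x = Orc (\<lambda>x. x \<bullet> e) (\<lambda>_. 0) x"
        using assms(2) adm adm_inner unfolding local_oracle_def q_def by blast
      then show ?thesis by blast
    qed
  qed

  \<comment> \<open>The index of a hole can be read off from any of its points.\<close>
  have "i = \<lfloor>N * (x \<bullet> e)\<rfloor>" if "x \<in> H i" for x i
  proof -
    have "real i \<le> N * (x \<bullet> e)" "N * (x \<bullet> e) \<le> real i + 1 / 2"
      using that Npos by (auto simp: H_def field_simps)
    then show ?thesis by linarith
  qed
  then have disj: "disjoint_family_on H {..<N}"
    unfolding disjoint_family_on_def by (metis disjoint_iff of_nat_eq_iff)

  have meas: "(\<lambda>\<omega>. iterate alg (q i) \<omega> t) \<in> borel_measurable M" if "t < T" for i t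
    using assms(3) adm that unfolding randomized_algorithm_def q_def by blast
  define B where "B i = {\<omega> \<in> space M. \<exists>t\<in>{..<T}. iterate alg (q i) \<omega> t \<in> H i}" for i
  have visit: "{\<omega> \<in> space M. \<exists>t\<in>{..<T}. iterate alg (q i) \<omega> t \<in> S} \<in> events"
    if "closed S" for S i
  proof (rule sets.sets_Collect_finite_Ex)
    fix t assume "t \<in> {..<T}"
    then show "{\<omega> \<in> space M. iterate alg (q i) \<omega> t \<in> S} \<in> events"
      using measurable_sets[OF meas borel_closed[OF that], of t i]
      by (simp add: vimage_def Int_def conj_commute)
  qed simp
  have B: "B i \<in> events" for i
    unfolding B_def H_def
    by (intro visit closed_Collect_conj closed_Collect_le continuous_intros)
  have "\<exists>i\<in>{..<N}. prob (B i) \<le> (T * 2 ^ T :: nat) / card {..<N}"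
  proof (rule exists_rare_event)
    fix \<omega> assume "\<omega> \<in> space M"
    then show "card {i \<in> {..<N}. \<omega> \<in> B i} \<le> T * 2 ^ T"
      using card_hit_holes_le[OF out disj, where T = T and alg = alg and \<omega> = \<omega>] by (simp add: B_def Bex_def)
  qed (use Npos B in auto)
  then obtain i where i: "i < N" "prob (B i) \<le> T * 2 ^ T / N" by auto

  let ?p = "real i / N"
  let ?good = "{\<omega> \<in> space M. \<forall>t\<in>{..<T}. iterate alg (q i) \<omega> t \<bullet> e \<noteq> ?p}"
  have p: "0 \<le> ?p" "?p \<le> 1" using i(1) by auto
  have good: "?good = {\<omega> \<in> space M. \<forall>\<epsilon>\<in>{0<..<1 / (4 * sqrt 2)}. \<forall>\<gamma>\<in>{0<..1 / 10}. \<forall>t<T.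
        \<not> PGSP (F i) (\<lambda>_. 0) \<gamma> \<epsilon> (iterate alg (Orc (F i) (\<lambda>_. 0)) \<omega> t) \<and>
        \<not> CGGSP (F i) (\<lambda>_. 0) \<epsilon> (iterate alg (Orc (F i) (\<lambda>_. 0)) \<omega> t)}"
    unfolding F_def[of i] ridge_stationary_iff[OF e K p(1), symmetric] q_def by auto
  have "closed {x. x \<bullet> e = ?p}" by (intro closed_Collect_eq continuous_intros)
  from sets.compl_sets[OF visit[OF this, of i]] have ev: "?good \<in> events"
    by (rule back_subst[of "\<lambda>A. A \<in> events"]) auto
  have "1 - prob (B i) = prob (space M - B i)" using B by (simp add: prob_compl)
  also have "\<dots> \<le> prob ?good"
  proof (rule finite_measure_mono[OF _ ev], rule subsetI)
    have "x \<in> H i" if "x \<bullet> e = ?p" for x using that by (simp add: H_def)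
    then show "\<omega> \<in> ?good" if "\<omega> \<in> space M - B i" for \<omega> using that by (auto simp: B_def)
  qed
  finally have "1 - T * 2 ^ T / N \<le> prob ?good" using i(2) by linarith
  moreover have "T * 2 ^ T / N \<le> 2 * real T * exp (- real CARD('n) / 36)"
  proof -
    have "T * 2 ^ T / N \<le> T * 2 ^ T / (2 ^ T * exp (real CARD('n) / 36))"
      using N Npos by (intro divide_left_mono) auto
    also have "\<dots> = T * exp (- real CARD('n) / 36)"
      by (simp add: exp_minus field_simps)
    also have "\<dots> \<le> 2 * real T * exp (- real CARD('n) / 36)" by simp
    finally show ?thesis .
  qed
  ultimately have prob: "1 - 2 * real T * exp (- real CARD('n) / 36) \<le> prob ?good" by linarith

  have "objective (F i) (\<lambda>_. 0) 0 = 0"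
    using valley_left[OF K, of 0 ?p] p by (simp add: objective_def F_def ridge_def)
  moreover have "- 1 \<le> (INF x. objective (F i) (\<lambda>_. 0) x)"
  proof (rule INF_greatest)
    fix x
    have "- 1 \<le> F i x"
      using valley_minimum(1)[OF K p(1), of "x \<bullet> e"] p by (simp add: F_def ridge_def)
    then show "- 1 \<le> objective (F i) (\<lambda>_. 0) x" by (simp add: objective_def one_ereal_def)
  qed
  ultimately have "objective (F i) (\<lambda>_. 0) 0 - (INF x. objective (F i) (\<lambda>_. 0) x) \<le> 0 - (- 1)"
    by (simp only: ereal_minus_mono)
  also have "\<dots> \<le> (2::ereal)" by simp
  finally have gap: "objective (F i) (\<lambda>_. 0) 0 - (INF x. objective (F i) (\<lambda>_. 0) x) \<le> 2" .

  show ?thesis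
    using adm[of i] gap prob unfolding good admissible_def
    by (intro exI[of _ "F i"] exI[of _ "\<lambda>_. 0"]) auto
qed

end
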